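(* Let $P$ be a pattern that contains four 1-entries $x_1,x_2,x_3,x_4$ such that for each $i\in\{1,2,3,4\}$, there is no other 1-entry of $P$ in the same row or in the same column as $x_i$, and $x_i$ lies in the first row, the last row, the first column, or the last column of $P$; and such that the $4\times 4$ submatrix of $P$ formed by the rows and columns of $x_1,x_2,x_3,x_4$ is one of the two matrices $$\begin{pmatrix}0&1&0&0\\0&0&0&1\\1&0&0&0\\0&0&1&0\end{pmatrix},\qquad \begin{pmatrix}0&0&1&0\\1&0&0&0\\0&0&0&1\\0&1&0&0\end{pmatrix}.$$ Then $\mathrm{sat}(P,n)\in\mathcal{O}(1)$.
   Context: All matrices are 0-1 matrices; a pattern is a 0-1 matrix that is not all-zero. A matrix $M$ contains a pattern $P$ if $P$ can be obtained from $M$ by deleting rows and/or columns and changing arbitrary 1-entries into 0-entries; otherwise $M$ avoids $P$. A matrix $M$ is $P$-saturating if it avoids $P$ but changing any single 0-entry of $M$ into a 1 yields a matrix containing $P$. $\mathrm{sat}(P,n)$ is the minimum number of 1-entries of an $n\times n$ $P$-saturating matrix; the constant in $\mathcal{O}(1)$ may depend on $P$. *)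

theory Defs
  imports "Jordan_Normal_Form.DL_Submatrix" "HOL-Library.Landau_Symbols"
begin

text \<open>A 0-1 matrix is a \<^typ>\<open>bool mat\<close>, with \<^term>\<open>True\<close> for 1 and \<^term>\<open>False\<close> for 0.
  Rows and columns are numbered from 0.\<close>

type_synonym zo_mat = "bool mat"

definition one_entries :: "zo_mat \<Rightarrow> (nat \<times> nat) set" where
  "one_entries M = {(i, j). i < dim_row M \<and> j < dim_col M \<and> M $$ (i, j)}"

definition weight :: "zo_mat \<Rightarrow> nat" where
  "weight M = card (one_entries M)"

definition is_pattern :: "zo_mat \<Rightarrow> bool" where
  "is_pattern P \<longleftrightarrow> one_entries P \<noteq> {}"

text \<open>\<^term>\<open>I\<close> and \<^term>\<open>J\<close> are the sets of rows and columns that are kept; all others are deleted.\<close>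

definition contains_pattern :: "zo_mat \<Rightarrow> zo_mat \<Rightarrow> bool" where
  "contains_pattern M P \<longleftrightarrow>
     (\<exists>I J. dim_row (submatrix M I J) = dim_row P \<and> dim_col (submatrix M I J) = dim_col P \<and>
            one_entries P \<subseteq> one_entries (submatrix M I J))"

abbreviation avoids_pattern :: "zo_mat \<Rightarrow> zo_mat \<Rightarrow> bool" where
  "avoids_pattern M P \<equiv> \<not> contains_pattern M P"

definition saturating :: "zo_mat \<Rightarrow> zo_mat \<Rightarrow> bool" where
  "saturating P M \<longleftrightarrow> avoids_pattern M P \<and>
     (\<forall>i < dim_row M. \<forall>j < dim_col M. \<not> M $$ (i, j) \<longrightarrow>
        contains_pattern (update_mat M (i, j) True) P)"

definition sat :: "zo_mat \<Rightarrow> nat \<Rightarrow> nat" where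
  "sat P n = (LEAST w. \<exists>M \<in> carrier_mat n n. saturating P M \<and> weight M = w)"

definition isolated_one :: "zo_mat \<Rightarrow> nat \<times> nat \<Rightarrow> bool" where
  "isolated_one P x \<longleftrightarrow> x \<in> one_entries P \<and>
     (\<forall>y \<in> one_entries P. y \<noteq> x \<longrightarrow> fst y \<noteq> fst x \<and> snd y \<noteq> snd x)"

definition on_boundary :: "zo_mat \<Rightarrow> nat \<times> nat \<Rightarrow> bool" where
  "on_boundary P x \<longleftrightarrow>
     fst x = 0 \<or> fst x = dim_row P - 1 \<or> snd x = 0 \<or> snd x = dim_col P - 1"

definition Q1 :: zo_mat where
  "Q1 = mat_of_rows_list 4
     [[False, True,  False, False],
      [False, False, False, True ],
      [True,  False, False, False],
      [False, False, True,  False]]"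

definition Q2 :: zo_mat where
  "Q2 = mat_of_rows_list 4
     [[False, False, True,  False],
      [True,  False, False, False],
      [False, False, False, True ],
      [False, True,  False, False]]"

text \<open>The minimum in \<^const>\<open>sat\<close> is over a nonempty set, for every pattern and every size
  (including 0).\<close>

lemma finite_one_entries: "finite (one_entries M)"
  by (rule finite_subset[of _ "{..<dim_row M} \<times> {..<dim_col M}"]) (auto simp: one_entries_def)

lemma ex_saturating:
  assumes "is_pattern P"
  shows "\<exists>M \<in> carrier_mat n n. saturating P M"
proof -
  define A where "A M \<longleftrightarrow> M \<in> carrier_mat n n \<and> avoids_pattern M P" for M :: zo_mat
  define Z :: zo_mat where "Z = mat n n (\<lambda>_. False)"
  have pick_less: "pick K k < m" if "k < card {i. i < m \<and> i \<in> K}" for K k m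
    using pick_le[OF that] .
  have "one_entries (submatrix Z I J) = {}" for I J
    by (auto simp: one_entries_def Z_def submatrix_def pick_less)
  with assms have "A Z"
    by (auto simp: A_def contains_pattern_def is_pattern_def) (simp add: Z_def)
  moreover have "weight M \<le> n * n" if "A M" for M
  proof -
    have "one_entries M \<subseteq> {..<n} \<times> {..<n}"
      using that by (auto simp: one_entries_def A_def)
    then have "card (one_entries M) \<le> card ({..<n} \<times> {..<n})"
      by (intro card_mono) auto
    then show ?thesis by (simp add: weight_def)
  qed
  ultimately obtain M where M: "A M" and max: "\<And>N. A N \<Longrightarrow> weight N \<le> weight M"
    using ex_has_greatest_nat[of A Z weight "Suc (n * n)"] by (metis le_imp_less_Suc)
  have "contains_pattern (update_mat M (i, j) True) P"
    if ij: "i < dim_row M" "j < dim_col M" "\<not> M $$ (i, j)" for i j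
  proof (rule ccontr)
    let ?N = "update_mat M (i, j) True"
    assume "avoids_pattern ?N P"
    then have "A ?N" using M by (auto simp: A_def)
    have "one_entries ?N = insert (i, j) (one_entries M)"
      using ij by (auto simp: one_entries_def update_mat_def)
    moreover have "(i, j) \<notin> one_entries M"
      using ij by (simp add: one_entries_def)
    ultimately have "weight ?N = Suc (weight M)"
      by (simp add: weight_def finite_one_entries)
    with \<open>A ?N\<close> show False using max by fastforce
  qed
  with M show ?thesis by (auto simp: A_def saturating_def)
qed

end

theory Submission
  imports Defs
begin

text \<open>Let the first and last row of \<open>P\<close> have their only 1-entries in columns \<open>t\<close> and \<open>b\<close>, and
  the first and last column in rows \<open>l\<close> and \<open>r\<close>; then \<open>t < b\<close> and \<open>r < l\<close>, up to transposition.
  Delete the right entry from one copy of \<open>P\<close> and the left entry from another, and put the first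
  to the left of the second such that the now empty rows \<open>r\<close> and \<open>l\<close> coincide. A 1 anywhere in this
  row completes one of the copies. Yet \<open>P\<close> does not occur: depending on which copies contain the
  top and the bottom entry of an occurrence, the height of the copies forces the image of row \<open>l\<close>
  or \<open>r\<close> into the empty row. This survives any repetition of the empty row. Transposing gives the
  same for columns, and as \<open>r < l\<close>, no occurrence of \<open>P\<close> can use both blocks of the block diagonal
  matrix of the two constructions. Every saturating matrix above the result is zero in
  the repeated rows and columns, hence has bounded weight.\<close>

section \<open>Pattern containment as a pair of increasing maps\<close>

text \<open>Working with bare sets of 1-entries turns transposition into converse and a flipped 0
  into \<open>insert\<close>; matrix dimensions do not enter.\<close>

definition occurs :: "nat \<Rightarrow> nat \<Rightarrow> (nat \<times> nat) set \<Rightarrow> (nat \<times> nat) set \<Rightarrow> bool" where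
  "occurs p q S E \<longleftrightarrow> (\<exists>f g. strict_mono_on {..<p} f \<and> strict_mono_on {..<q} g \<and>
     (\<forall>i j. (i, j) \<in> S \<longrightarrow> (f i, g j) \<in> E))"

lemma occurs_converse: "occurs q p (S\<inverse>) (E\<inverse>) \<longleftrightarrow> occurs p q S E"
  unfolding occurs_def by auto

lemma occurs_mono: "occurs p q S E \<Longrightarrow> E \<subseteq> F \<Longrightarrow> occurs p q S F"
  unfolding occurs_def by blast

lemma strict_mono_on_gap:
  fixes f :: "nat \<Rightarrow> nat"
  assumes "strict_mono_on {..<p} f" "i \<le> j" "j < p"
  shows "f i + (j - i) \<le> f j"
  using assms(2,3)
proof (induction j rule: dec_induct)
  case (step j)
  with assms(1) have "f j < f (Suc j)" by (auto simp: strict_mono_on_def)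
  with step show ?case by simp
qed simp

lemma strict_mono_on_le_last:
  fixes f :: "nat \<Rightarrow> nat"
  assumes "strict_mono_on {..<p} f" "i < p"
  shows "f i + (p - 1 - i) \<le> f (p - 1)"
proof -
  have "i \<le> p - 1" "p - 1 < p" using assms(2) by auto
  from strict_mono_on_gap[OF assms(1) this] show ?thesis .
qed

lemma strict_mono_on_pick: "strict_mono_on {..<card {i. i < m \<and> i \<in> K}} (pick K)"
proof (rule strict_mono_onI)
  fix x y assume xy: "x \<in> {..<card {i. i < m \<and> i \<in> K}}" "y \<in> {..<card {i. i < m \<and> i \<in> K}}" "x < y"
  have "card {i. i < m \<and> i \<in> K} \<le> card K" if "finite K"
    using that by (intro card_mono) auto
  with xy show "pick K x < pick K y"
    by (cases "finite K") (auto intro!: pick_mono)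
qed

lemma pick_image_strict_mono:
  fixes f :: "nat \<Rightarrow> nat"
  assumes f: "strict_mono_on {..<p} f" and i: "i < p"
  shows "pick (f ` {..<p}) i = f i"
proof -
  have inj: "inj_on f {..<p}" using f by (rule strict_mono_on_imp_inj_on)
  have "{a \<in> f ` {..<p}. a < f i} = f ` {..<i}"
    using i f by (auto simp: strict_mono_on_less)
  then have "card {a \<in> f ` {..<p}. a < f i} = i"
    using card_image[OF inj_on_subset[OF inj, of "{..<i}"]] i by auto
  then show ?thesis using pick_card_in_set[of "f i" "f ` {..<p}"] i by auto
qed

text \<open>\<open>occurs\<close> ignores the size of \<open>M\<close>. The 1-entries in the last
  row and the last column of \<open>P\<close> force the images of these two lines into
  \<open>M\<close>, and monotonicity brings all earlier lines along.\<close>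

lemma contains_pattern_iff_occurs:
  assumes P: "(0, t) \<in> one_entries P" "(dim_row P - 1, b) \<in> one_entries P"
    "(l, 0) \<in> one_entries P" "(r, dim_col P - 1) \<in> one_entries P"
  shows "contains_pattern M P \<longleftrightarrow>
    occurs (dim_row P) (dim_col P) (one_entries P) (one_entries M)"
proof
  let ?p = "dim_row P" and ?q = "dim_col P"
  assume "contains_pattern M P"
  then obtain I J where IJ: "dim_row (submatrix M I J) = ?p" "dim_col (submatrix M I J) = ?q"
      "one_entries P \<subseteq> one_entries (submatrix M I J)"
    by (auto simp: contains_pattern_def)
  then have card: "card {i. i < dim_row M \<and> i \<in> I} = ?p" "card {j. j < dim_col M \<and> j \<in> J} = ?q"
    by (auto simp: dim_submatrix)
  have "(pick I i, pick J j) \<in> one_entries M" if "(i, j) \<in> one_entries P" for i j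
  proof -
    from that IJ(3) have ij: "i < ?p" "j < ?q" "submatrix M I J $$ (i, j)"
      by (auto simp: one_entries_def)
    with card have "submatrix M I J $$ (i, j) = M $$ (pick I i, pick J j)"
      by (simp add: submatrix_index)
    with ij card show ?thesis
      using pick_le[of i "dim_row M" I] pick_le[of j "dim_col M" J] by (auto simp: one_entries_def)
  qed
  with strict_mono_on_pick[of "dim_row M" I] strict_mono_on_pick[of "dim_col M" J] card
  show "occurs ?p ?q (one_entries P) (one_entries M)" by (auto simp: occurs_def)
next
  let ?p = "dim_row P" and ?q = "dim_col P"
  assume "occurs ?p ?q (one_entries P) (one_entries M)"
  then obtain f g where f: "strict_mono_on {..<?p} f" and g: "strict_mono_on {..<?q} g"
    and E: "\<And>i j. (i, j) \<in> one_entries P \<Longrightarrow> (f i, g j) \<in> one_entries M"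
    by (auto simp: occurs_def)
  have fl: "f i < dim_row M" if "i < ?p" for i
    using E[OF P(2)] strict_mono_on_le_last[OF f that] by (auto simp: one_entries_def)
  have gl: "g j < dim_col M" if "j < ?q" for j
    using E[OF P(4)] strict_mono_on_le_last[OF g that] by (auto simp: one_entries_def)
  let ?I = "f ` {..<?p}" and ?J = "g ` {..<?q}"
  have "{i. i < dim_row M \<and> i \<in> ?I} = ?I" "{j. j < dim_col M \<and> j \<in> ?J} = ?J"
    using fl gl by auto
  then have card: "card {i. i < dim_row M \<and> i \<in> ?I} = ?p" "card {j. j < dim_col M \<and> j \<in> ?J} = ?q"
    using f g by (simp_all add: card_image strict_mono_on_imp_inj_on)
  have "(i, j) \<in> one_entries (submatrix M ?I ?J)" if ij: "(i, j) \<in> one_entries P" for i j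
  proof -
    have "i < ?p" "j < ?q" using ij by (auto simp: one_entries_def)
    moreover from this card have "submatrix M ?I ?J $$ (i, j) = M $$ (pick ?I i, pick ?J j)"
      by (simp add: submatrix_index)
    ultimately show ?thesis using E[OF ij] card f g
      by (simp add: one_entries_def dim_submatrix pick_image_strict_mono)
  qed
  then have "one_entries P \<subseteq> one_entries (submatrix M ?I ?J)" by auto
  with card show "contains_pattern M P"
    unfolding contains_pattern_def by (intro exI[of _ ?I] exI[of _ ?J]) (simp add: dim_submatrix)
qed

section \<open>The construction with a repeated empty row\<close>

text \<open>The equivalences isolate the top, bottom, left and right entries. The last two
  alternatives are the arrangements of \<open>Q1\<close> and \<open>Q2\<close>; transposing
  exchanges them.\<close>

definition framed :: "nat \<Rightarrow> nat \<Rightarrow> (nat \<times> nat) set \<Rightarrow> nat \<Rightarrow> nat \<Rightarrow> nat \<Rightarrow> nat \<Rightarrow> bool" where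
  "framed p q S t b l r \<longleftrightarrow> S \<subseteq> {..<p} \<times> {..<q} \<and>
     {(0, t), (p - 1, b), (l, 0), (r, q - 1)} \<subseteq> S \<and>
     (\<forall>i j. (i, j) \<in> S \<longrightarrow>
        (i = 0 \<longleftrightarrow> j = t) \<and> (i = p - 1 \<longleftrightarrow> j = b) \<and> (i = l \<longleftrightarrow> j = 0) \<and> (i = r \<longleftrightarrow> j = q - 1)) \<and>
     (t < b \<and> r < l \<or> b < t \<and> l < r)"

lemma framed_converse: "framed p q S t b l r \<Longrightarrow> framed q p (S\<inverse>) l r t b"
  unfolding framed_def by auto

text \<open>Row \<open>k\<close> of the copy goes to \<open>x\<close>, which is meant to be in \<open>{s..<s + N}\<close>.\<close>

definition stretch :: "nat \<Rightarrow> nat \<Rightarrow> nat \<Rightarrow> nat \<Rightarrow> nat \<Rightarrow> nat" where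
  "stretch s N k x i = (if i < k then i + (s - k) else if i = k then x else i + (s - k) + (N - 1))"

text \<open>The copy of the pattern without its right entry is on the left, the copy without its left
  entry is on the right, and the rows of the missing entries coincide; this row is repeated
  \<^term>\<open>N\<close> times, as the empty rows \<^term>\<open>{s..<s + N}\<close>.\<close>

definition row_witness ::
    "nat \<Rightarrow> (nat \<times> nat) set \<Rightarrow> nat \<Rightarrow> nat \<Rightarrow> nat \<Rightarrow> nat \<Rightarrow> nat \<Rightarrow> (nat \<times> nat) set" where
  "row_witness q S l r s c N =
     {(stretch s N l 0 i, c + q + j) | i j. (i, j) \<in> S \<and> i \<noteq> l} \<union>
     {(stretch s N r 0 i, c + j) | i j. (i, j) \<in> S \<and> i \<noteq> r}"

lemma stretch_strict_mono:
  assumes "s \<le> x" "x < s + N" "k < s"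
  shows "strict_mono_on {..<p} (stretch s N k x)"
  using assms by (auto simp: strict_mono_on_def stretch_def)

lemma stretch_bounds:
  assumes "i < p" "k < p" "p \<le> s" "i \<noteq> k" "0 < N"
  shows "s - k \<le> stretch s N k x i" "stretch s N k x i + k < s + p + N - 1"
    "stretch s N k x i \<notin> {s..<s + N}"
  using assms by (auto simp: stretch_def)

lemma row_witness_bounds:
  assumes fr: "framed p q S t b l r" and s: "p \<le> s" and N: "0 < N"
  shows "row_witness q S l r s c N \<subseteq> {s - p..<s + p + N} \<times> {c..<c + 2 * q}"
proof
  fix z assume "z \<in> row_witness q S l r s c N"
  then obtain i j k where "(i, j) \<in> S" "i \<noteq> k" "k = l \<or> k = r" "fst z = stretch s N k 0 i"
    "snd z = c + q + j \<or> snd z = c + j"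
    by (auto simp: row_witness_def)
  moreover from this fr have "i < p" "k < p" "j < q" by (auto simp: framed_def)
  ultimately show "z \<in> {s - p..<s + p + N} \<times> {c..<c + 2 * q}"
    using stretch_bounds(1,2)[of i p k s N 0] s N by (cases z) auto
qed

lemma row_witness_avoids:
  assumes fr: "framed p q S t b l r" and s: "p \<le> s" and N: "0 < N"
  shows "\<not> occurs p q S (row_witness q S l r s c N)"
proof
  let ?W = "row_witness q S l r s c N"
  assume "occurs p q S ?W"
  then obtain f g where f: "strict_mono_on {..<p} f" and g: "strict_mono_on {..<q} g"
    and E: "\<And>i j. (i, j) \<in> S \<Longrightarrow> (f i, g j) \<in> ?W"
    by (auto simp: occurs_def)
  from fr have lt: "t < q" "b < q" "l < p" "r < p" and S: "S \<subseteq> {..<p} \<times> {..<q}"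
    and inS: "(0, t) \<in> S" "(p - 1, b) \<in> S" "(l, 0) \<in> S" "(r, q - 1) \<in> S"
    and spiral: "t < b \<and> r < l \<or> b < t \<and> l < r"
    by (auto simp: framed_def)
  \<comment> \<open>The column of an entry tells its copy: from \<open>c + q\<close> on it is the
    right one, which lacks row \<open>l\<close>, and before that the left one, which lacks row
    \<open>r\<close>.\<close>
  have bounds: "s - k \<le> x \<and> x + k < s + p + N - 1 \<and> x \<notin> {s..<s + N}"
    if "(x, y) \<in> ?W" "k = (if c + q \<le> y then l else r)" for x y k
  proof -
    have "\<exists>i j. (i, j) \<in> S \<and> i \<noteq> k \<and> x = stretch s N k 0 i"
      using that S by (fastforce simp: row_witness_def)
    then obtain i where "i < p" "i \<noteq> k" "x = stretch s N k 0 i"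
      using S by auto
    then show ?thesis using stretch_bounds[of i p k s N 0] that(2) lt s N by auto
  qed
  have gap: "\<not> (s \<le> f l \<and> f l < s + N)" "\<not> (s \<le> f r \<and> f r < s + N)"
    using bounds[OF E[OF inS(3)] refl] bounds[OF E[OF inS(4)] refl] by auto
  have f_lr: "r < l \<Longrightarrow> f r < f l" "l < r \<Longrightarrow> f l < f r"
    using f lt by (auto simp: strict_mono_on_def)
  have g_tb: "t < b \<Longrightarrow> g t < g b" "b < t \<Longrightarrow> g b < g t"
    using g lt by (auto simp: strict_mono_on_def)
  \<comment> \<open>If the top entry lands in the copy lacking row \<open>k\<close>, then
    \<open>f 0\<close> is at least \<open>s - k\<close>, and \<open>k\<close> further rows lead to
    \<open>s\<close> or beyond. \<open>upper\<close> counts back from the bottom entry in the same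
    way.\<close>
  have lower: "s \<le> f k" if "k = (if c + q \<le> g t then l else r)" for k
    using bounds[OF E[OF inS(1)] that] strict_mono_on_gap[OF f, of 0 k] that lt by auto
  have upper: "f k < s + N" if "k = (if c + q \<le> g b then l else r)" for k
    using bounds[OF E[OF inS(2)] that] strict_mono_on_le_last[OF f, of k] that lt
    by (auto split: if_splits)
  \<comment> \<open>If both entries land in one copy, its missing row is mapped into the gap.
    Otherwise the order of \<open>t\<close> and \<open>b\<close> decides which copy holds which; for
    \<open>t < b\<close> this gives \<open>s \<le> f r < f l < s + N\<close>, and for
    \<open>b < t\<close> the same with \<open>l\<close> and \<open>r\<close> exchanged.\<close>
  show False
    using lower[OF refl] upper[OF refl] gap f_lr g_tb spiral by (auto split: if_splits)
qed

text \<open>The new 1 replaces the missing left entry of the right copy or the missing right entry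
  of the left copy, depending on \<open>y\<close>. As \<open>y\<close> is arbitrary, this also
  covers columns outside the witness.\<close>

lemma row_witness_expandable:
  assumes fr: "framed p q S t b l r" and s: "p \<le> s" and x: "x \<in> {s..<s + N}"
  shows "occurs p q S (insert (x, y) (row_witness q S l r s c N))"
proof -
  let ?W = "row_witness q S l r s c N"
  from fr have lt: "l < s" "r < s" and S: "S \<subseteq> {..<p} \<times> {..<q}"
    and iso: "\<And>i j. (i, j) \<in> S \<Longrightarrow> (i = l \<longleftrightarrow> j = 0) \<and> (i = r \<longleftrightarrow> j = q - 1)"
    using s by (auto simp: framed_def)
  have eq: "stretch s N k x i = (if i = k then x else stretch s N k 0 i)" for k i
    by (simp add: stretch_def)
  have mono: "strict_mono_on {..<p} (stretch s N k x)" if "k < s" for k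
    using that x by (intro stretch_strict_mono) auto
  show ?thesis
  proof (cases "y \<le> c + q")
    case True
    \<comment> \<open>Column 0 is free to move to \<open>y\<close>: its only entry is the missing
      one, in row \<open>l\<close>.\<close>
    let ?g = "\<lambda>j. if j = 0 then y else c + q + j"
    have "(stretch s N l x i, ?g j) \<in> insert (x, y) ?W" if ij: "(i, j) \<in> S" for i j
      using iso[OF ij] ij by (auto simp: row_witness_def eq)
    moreover have "strict_mono_on {..<q} ?g"
      using True by (auto simp: strict_mono_on_def)
    ultimately show ?thesis
      unfolding occurs_def using mono[OF lt(1)] by blast
  next
    case False
    let ?g = "\<lambda>j. if j = q - 1 then y else c + j"
    have "(stretch s N r x i, ?g j) \<in> insert (x, y) ?W" if ij: "(i, j) \<in> S" for i j
      using iso[OF ij] ij by (auto simp: row_witness_def eq)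
    moreover have "strict_mono_on {..<q} ?g"
      using False by (auto simp: strict_mono_on_def)
    ultimately show ?thesis
      unfolding occurs_def using mono[OF lt(2)] by blast
  qed
qed

section \<open>Combining empty rows and empty columns\<close>

definition expandable :: "nat \<Rightarrow> nat \<Rightarrow> (nat \<times> nat) set \<Rightarrow> nat \<Rightarrow> (nat \<times> nat) set \<Rightarrow> nat set \<Rightarrow> nat set \<Rightarrow> bool" where
  "expandable p q S n E R C \<longleftrightarrow> E \<subseteq> {..<n} \<times> {..<n} \<and> \<not> occurs p q S E \<and>
     (\<forall>x y. x \<in> R \<or> y \<in> C \<longrightarrow> occurs p q S (insert (x, y) E)) \<and>
     card ({..<n} - R) \<le> 4 * p \<and> card ({..<n} - C) \<le> 4 * q"

lemma expandable_converse:
  assumes "expandable p q S n E R C"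
  shows "expandable q p (S\<inverse>) n (E\<inverse>) C R"
proof -
  have "insert (y, x) (E\<inverse>) = (insert (x, y) E)\<inverse>" for x y by auto
  with assms show ?thesis unfolding expandable_def by (auto simp: occurs_converse)
qed

lemma ex_expandable_if_less:
  assumes fr: "framed p q S t b l r" and tb: "t < b" and n: "4 * p + 4 * q < n"
  shows "\<exists>E R C. expandable p q S n E R C"
proof -
  define N1 N2 where "N1 = n - 4 * p" and "N2 = n - 4 * q"
  then have N: "0 < N1" "0 < N2" "4 * p + N1 = n" "4 * q + N2 = n" using n by auto
  \<comment> \<open>\<open>W1\<close> gets \<open>2 * p + N1\<close> rows and \<open>2 * q\<close>
    columns, \<open>W2\<close> gets \<open>2 * p\<close> rows and \<open>2 * q + N2\<close> columns;
    placed diagonally they fill size \<open>n\<close>. The gap of \<open>W2\<close> starts at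
    \<open>3 * q\<close>: \<open>2 * q\<close> columns for \<open>W1\<close>, then \<open>q\<close>
    for the part of \<open>W2\<close> before the gap.\<close>
  define W1 where "W1 = row_witness q S l r p 0 N1"
  define W2 where "W2 = (row_witness p (S\<inverse>) t b (3 * q) (2 * p + N1) N2)\<inverse>"
  define E where "E = W1 \<union> W2"
  note fr' = framed_converse[OF fr]
  have W1: "W1 \<subseteq> {..<2 * p + N1} \<times> {..<2 * q}" "\<not> occurs p q S W1"
    using row_witness_bounds[OF fr, of p N1 0] row_witness_avoids[OF fr, of p N1 0] N
    by (auto simp: W1_def)
  have W2: "W2 \<subseteq> {2 * p + N1..<n} \<times> {2 * q..<n}" "\<not> occurs p q S W2"
    using row_witness_bounds[OF fr', of "3 * q" N2 "2 * p + N1"]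
      row_witness_avoids[OF fr', of "3 * q" N2 "2 * p + N1"] N
      occurs_converse[of p q "S\<inverse>" "row_witness p (S\<inverse>) t b (3 * q) (2 * p + N1) N2"]
    by (auto simp: W2_def)
  from fr tb have inS: "(0, t) \<in> S" "(p - 1, b) \<in> S" "(l, 0) \<in> S" "(r, q - 1) \<in> S"
    and rl: "r < l" and S: "S \<subseteq> {..<p} \<times> {..<q}"
    by (auto simp: framed_def)
  have E_bounds: "E \<subseteq> {..<n} \<times> {..<n}"
    using W1(1) W2(1) N by (fastforce simp: E_def)
  have avoids: "\<not> occurs p q S E"
  proof
    assume "occurs p q S E"
    then obtain f g where f: "strict_mono_on {..<p} f" and g: "strict_mono_on {..<q} g"
      and fg: "\<And>i j. (i, j) \<in> S \<Longrightarrow> (f i, g j) \<in> E"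
      by (auto simp: occurs_def)
    have g_le: "g i \<le> g j" if "i \<le> j" "j < q" for i j
      using strict_mono_on_gap[OF g that] by simp
    have EW1: "(x, y) \<in> W1" "x < 2 * p + N1" if "(x, y) \<in> E" "y < 2 * q" for x y
      using that W1(1) W2(1) by (auto simp: E_def)
    have EW2: "(x, y) \<in> W2" "2 * p + N1 \<le> x" if "(x, y) \<in> E" "2 * q \<le> y" for x y
      using that W1(1) W2(1) by (auto simp: E_def)
    \<comment> \<open>Neither block alone contains the pattern, so the last column lands in
      \<open>W2\<close> and the first in \<open>W1\<close>. Then \<open>f r\<close> exceeds
      \<open>f l\<close>, against \<open>r < l\<close>.\<close>
    have "2 * q \<le> g (q - 1)"
    proof (rule ccontr)
      assume *: "\<not> 2 * q \<le> g (q - 1)"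
      have "(f i, g j) \<in> W1" if "(i, j) \<in> S" for i j
        using EW1(1)[OF fg[OF that]] g_le[of j "q - 1"] S that * by fastforce
      with W1(2) f g show False by (auto simp: occurs_def)
    qed
    then have "2 * p + N1 \<le> f r" using EW2(2)[OF fg[OF inS(4)]] by simp
    moreover have "g 0 < 2 * q"
    proof (rule ccontr)
      assume *: "\<not> g 0 < 2 * q"
      have "(f i, g j) \<in> W2" if "(i, j) \<in> S" for i j
        using EW2(1)[OF fg[OF that]] g_le[of 0 j] S that * by fastforce
      with W2(2) f g show False by (auto simp: occurs_def)
    qed
    then have "f l < 2 * p + N1" using EW1(2)[OF fg[OF inS(3)]] by simp
    moreover have "f r \<le> f l"
      using strict_mono_on_gap[OF f, of r l] rl inS S by auto
    ultimately show False by simp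
  qed
  have rows: "occurs p q S (insert (x, y) E)" if "x \<in> {p..<p + N1}" for x y
    using row_witness_expandable[OF fr order_refl that, of y 0]
    by (rule occurs_mono) (auto simp: E_def W1_def)
  have cols: "occurs p q S (insert (x, y) E)" if y: "y \<in> {3 * q..<3 * q + N2}" for x y
  proof -
    have "occurs q p (S\<inverse>) ((insert (x, y) W2)\<inverse>)"
      using row_witness_expandable[OF fr' _ y, of x "2 * p + N1"]
      by (rule occurs_mono) (auto simp: W2_def)
    then show ?thesis unfolding occurs_converse by (rule occurs_mono) (auto simp: E_def)
  qed
  have "{..<n} - {p..<p + N1} = {..<p} \<union> {p + N1..<n}"
    using N by auto
  then have "card ({..<n} - {p..<p + N1}) \<le> 4 * p"
    using card_Un_le[of "{..<p}" "{p + N1..<n}"] N by simp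
  moreover have "{..<n} - {3 * q..<3 * q + N2} = {..<3 * q} \<union> {3 * q + N2..<n}"
    using N by auto
  then have "card ({..<n} - {3 * q..<3 * q + N2}) \<le> 4 * q"
    using card_Un_le[of "{..<3 * q}" "{3 * q + N2..<n}"] N by simp
  ultimately have "expandable p q S n E {p..<p + N1} {3 * q..<3 * q + N2}"
    using E_bounds avoids rows cols unfolding expandable_def by blast
  then show ?thesis by blast
qed

text \<open>If \<open>t < b\<close> fails, then \<open>l < r\<close>, which is the required
  inequality for the transposed frame.\<close>

lemma ex_expandable:
  assumes fr: "framed p q S t b l r" and n: "4 * p + 4 * q < n"
  shows "\<exists>E R C. expandable p q S n E R C"
proof (cases "t < b")
  case True
  with assms show ?thesis by (intro ex_expandable_if_less)
next
  case False
  with fr have "l < r" by (auto simp: framed_def)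
  then obtain E R C where "expandable q p (S\<inverse>) n E R C"
    using ex_expandable_if_less[OF framed_converse[OF fr], of n] n by auto
  from expandable_converse[OF this] show ?thesis by auto
qed

section \<open>From a maximal avoiding set to the bound on \<open>sat\<close>\<close>

lemma one_entries_mat_of_set:
  assumes "E \<subseteq> {..<n} \<times> {..<n}"
  shows "one_entries (mat n n (\<lambda>x. x \<in> E)) = E"
  using assms by (auto simp: one_entries_def)

lemma sat_le_of_expandable:
  assumes fr: "framed (dim_row P) (dim_col P) (one_entries P) t b l r"
    and ex: "expandable (dim_row P) (dim_col P) (one_entries P) n E R C"
  shows "sat P n \<le> (4 * dim_row P) * (4 * dim_col P)"
proof -
  let ?occ = "occurs (dim_row P) (dim_col P) (one_entries P)"
  let ?box = "{..<n} \<times> {..<n}"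
  have contains: "contains_pattern M P \<longleftrightarrow> ?occ (one_entries M)" for M
    using fr by (intro contains_pattern_iff_occurs[of t P b l r]) (auto simp: framed_def)
  from ex have E: "E \<subseteq> ?box" "\<not> ?occ E"
    and flip: "\<And>x y. x \<in> R \<or> y \<in> C \<Longrightarrow> ?occ (insert (x, y) E)"
    and card: "card ({..<n} - R) \<le> 4 * dim_row P" "card ({..<n} - C) \<le> 4 * dim_col P"
    by (auto simp: expandable_def)
  define A where "A = {F. F \<subseteq> ?box \<and> \<not> ?occ F}"
  have "finite A"
    unfolding A_def by (rule finite_subset[of _ "Pow ?box"]) auto
  moreover have "E \<in> A" using E by (simp add: A_def)
  ultimately obtain F where "F \<in> A" "E \<subseteq> F" and maxA: "\<forall>G\<in>A. F \<subseteq> G \<longrightarrow> F = G"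
    by (blast dest: finite_has_maximal2)
  then have F: "F \<subseteq> ?box" "\<not> ?occ F" "E \<subseteq> F" by (simp_all add: A_def)
  have max: "F = G" if "G \<subseteq> ?box" "\<not> ?occ G" "F \<subseteq> G" for G
    using maxA that by (simp add: A_def)
  define M where "M = mat n n (\<lambda>x. x \<in> F)"
  have M: "M \<in> carrier_mat n n" "one_entries M = F"
    using F(1) by (auto simp: M_def one_entries_mat_of_set)
  have "saturating P M"
    unfolding saturating_def
  proof (intro conjI allI impI)
    show "avoids_pattern M P" using F(2) M(2) by (simp add: contains)
    fix i j assume ij: "i < dim_row M" "j < dim_col M" "\<not> M $$ (i, j)"
    then have "one_entries (update_mat M (i, j) True) = insert (i, j) F"
      using M(2) by (auto simp: one_entries_def update_mat_def)
    moreover have "(i, j) \<notin> F" using ij by (auto simp: M_def)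
    moreover have "insert (i, j) F \<subseteq> ?box" using ij M(1) F(1) by auto
    ultimately show "contains_pattern (update_mat M (i, j) True) P"
      unfolding contains using max[of "insert (i, j) F"] by auto
  qed
  then have "sat P n \<le> weight M"
    unfolding sat_def using M(1) by (intro Least_le) auto
  also have "F \<subseteq> ({..<n} - R) \<times> ({..<n} - C)"
  proof
    fix z assume z: "z \<in> F"
    \<comment> \<open>\<open>insert z E\<close> is a subset of \<open>F\<close>, so a 1 of
      \<open>F\<close> in \<open>R\<close> or \<open>C\<close> would already yield an occurrence in
      \<open>F\<close>.\<close>
    then have "\<not> ?occ (insert z E)" using F(2,3) occurs_mono by (metis insert_subset)
    with flip z F(1) show "z \<in> ({..<n} - R) \<times> ({..<n} - C)" by (cases z) auto
  qed
  then have "weight M \<le> card (({..<n} - R) \<times> ({..<n} - C))"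
    unfolding weight_def M(2) by (intro card_mono) auto
  also have "\<dots> \<le> (4 * dim_row P) * (4 * dim_col P)"
    unfolding card_cartesian_product using card by (rule mult_le_mono)
  finally show ?thesis .
qed

section \<open>Reading the frame off the 4 by 4 submatrix\<close>

lemma framed_of_submatrix:
  assumes iso: "\<And>x. x \<in> X \<Longrightarrow> isolated_one P x \<and> on_boundary P x"
    and sub: "submatrix P (fst ` X) (snd ` X) \<in> {Q1, Q2}"
  shows "\<exists>t b l r. framed (dim_row P) (dim_col P) (one_entries P) t b l r"
proof -
  let ?p = "dim_row P" and ?q = "dim_col P" and ?I = "fst ` X" and ?J = "snd ` X"
  define u v where "u = pick ?I" and "v = pick ?J"
  have "dim_row (submatrix P ?I ?J) = 4" "dim_col (submatrix P ?I ?J) = 4"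
    using sub by (auto simp: Q1_def Q2_def mat_of_rows_list_def)
  then have card: "card {i. i < ?p \<and> i \<in> ?I} = 4" "card {j. j < ?q \<and> j \<in> ?J} = 4"
    by (auto simp: dim_submatrix)
  have u: "u 0 < u 1" "u 1 < u 2" "u 2 < u 3" "u 3 < ?p"
    using strict_mono_on_pick[of ?p ?I] pick_le[of 3 ?p ?I] card(1)
    by (auto simp: u_def strict_mono_on_def simp del: pick.simps)
  have v: "v 0 < v 1" "v 1 < v 2" "v 2 < v 3" "v 3 < ?q"
    using strict_mono_on_pick[of ?q ?J] pick_le[of 3 ?q ?J] card(2)
    by (auto simp: v_def strict_mono_on_def simp del: pick.simps)
  define unique where "unique i j \<longleftrightarrow> (i, j) \<in> one_entries P \<and> on_boundary P (i, j) \<and>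
    (\<forall>a c. (a, c) \<in> one_entries P \<longrightarrow> (a = i \<longleftrightarrow> c = j))" for i j
  have entry: "unique (u i) (v j)" if "i < 4" "j < 4" "submatrix P ?I ?J $$ (i, j)" for i j
  proof -
    have "P $$ (u i, v j)"
      using that card by (simp add: submatrix_index u_def v_def)
    moreover have lt: "u i < ?p" "v j < ?q"
      using that card pick_le[of i ?p ?I] pick_le[of j ?q ?J] by (auto simp: u_def v_def)
    ultimately have one: "(u i, v j) \<in> one_entries P" by (simp add: one_entries_def)
    \<comment> \<open>Row \<open>u i\<close> was selected because of some \<open>x\<close> in
      \<open>X\<close>; isolation identifies \<open>x\<close> with the 1-entry found in that
      row.\<close>
    have "u i \<in> ?I" unfolding u_def
      using that card pick_reduce_set[of i ?p ?I] pick_in_set_le[of i "{a. a < ?p \<and> a \<in> ?I}"] by simp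
    then obtain x where x: "x \<in> X" "fst x = u i" by auto
    with iso[OF x(1)] one have "x = (u i, v j)" unfolding isolated_one_def by (metis fst_conv)
    with iso[OF x(1)] one show ?thesis
      unfolding unique_def isolated_one_def by (metis fst_conv snd_conv)
  qed
  have sub_box: "one_entries P \<subseteq> {..<?p} \<times> {..<?q}" by (auto simp: one_entries_def)
  \<comment> \<open>Each 1-entry of \<open>Q1\<close> and \<open>Q2\<close> has one coordinate in
    {0, 3} and the other in {1, 2}. The latter cannot be extreme in \<open>P\<close>, so being on
    the boundary fixes the former.\<close>
  have inner: "u 0 \<noteq> ?p - 1" "u 1 \<noteq> ?p - 1" "u 2 \<noteq> ?p - 1" "u 1 \<noteq> 0" "u 2 \<noteq> 0" "u 3 \<noteq> 0"
      "v 0 \<noteq> ?q - 1" "v 1 \<noteq> ?q - 1" "v 2 \<noteq> ?q - 1" "v 1 \<noteq> 0" "v 2 \<noteq> 0" "v 3 \<noteq> 0"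
    using u v by linarith+
  from sub consider (1) "submatrix P ?I ?J = Q1" | (2) "submatrix P ?I ?J = Q2" by auto
  then show ?thesis
  proof cases
    case 1
    have e: "unique (u 0) (v 1)" "unique (u 3) (v 2)" "unique (u 2) (v 0)" "unique (u 1) (v 3)"
      by (rule entry; simp add: 1 Q1_def mat_of_rows_list_def)+
    then have "on_boundary P (u 0, v 1)" "on_boundary P (u 3, v 2)"
      "on_boundary P (u 2, v 0)" "on_boundary P (u 1, v 3)"
      unfolding unique_def by blast+
    then have eqs: "u 0 = 0" "u 3 = ?p - 1" "v 0 = 0" "v 3 = ?q - 1"
      using inner unfolding on_boundary_def fst_conv snd_conv by metis+
    have "framed ?p ?q (one_entries P) (v 1) (v 2) (u 2) (u 1)"
      using sub_box e u v unfolding framed_def unique_def eqs by blast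
    then show ?thesis by blast
  next
    case 2
    have e: "unique (u 0) (v 2)" "unique (u 3) (v 1)" "unique (u 1) (v 0)" "unique (u 2) (v 3)"
      by (rule entry; simp add: 2 Q2_def mat_of_rows_list_def)+
    then have "on_boundary P (u 0, v 2)" "on_boundary P (u 3, v 1)"
      "on_boundary P (u 1, v 0)" "on_boundary P (u 2, v 3)"
      unfolding unique_def by blast+
    then have eqs: "u 0 = 0" "u 3 = ?p - 1" "v 0 = 0" "v 3 = ?q - 1"
      using inner unfolding on_boundary_def fst_conv snd_conv by metis+
    have "framed ?p ?q (one_entries P) (v 2) (v 1) (u 1) (u 2)"
      using sub_box e u v unfolding framed_def unique_def eqs by blast
    then show ?thesis by blast
  qed
qed

theorem theorem1p2:
  fixes P :: zo_mat and x1 x2 x3 x4 :: "nat \<times> nat"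
  assumes "is_pattern P"
    and "distinct [x1, x2, x3, x4]"
    and "\<And>x. x \<in> {x1, x2, x3, x4} \<Longrightarrow> isolated_one P x \<and> on_boundary P x"
    and "submatrix P (fst ` {x1, x2, x3, x4}) (snd ` {x1, x2, x3, x4}) \<in> {Q1, Q2}"
  shows "(\<lambda>n. real (sat P n)) \<in> O(\<lambda>_. 1)"
proof -
  let ?p = "dim_row P" and ?q = "dim_col P"
  obtain t b l r where fr: "framed ?p ?q (one_entries P) t b l r"
    using framed_of_submatrix[OF assms(3,4)] by blast
  have "sat P n \<le> (4 * ?p) * (4 * ?q)" if "4 * ?p + 4 * ?q < n" for n
    using ex_expandable[OF fr that] sat_le_of_expandable[OF fr] by blast
  then have "norm (real (sat P n)) \<le> real ((4 * ?p) * (4 * ?q)) * norm (1 :: real)"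
    if "4 * ?p + 4 * ?q < n" for n
    using that by (simp del: of_nat_mult)
  then show ?thesis
    by (intro bigoI[OF eventually_mono[OF eventually_gt_at_top[of "4 * ?p + 4 * ?q"]]])
qed

end
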